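(* Let $(A,B)$ be a pair of complex $m\times n$ matrices. Then $(A,B)$ is transformed by an arbitrarily small perturbation to a pair equivalent to one of the form below; that is, for every $\varepsilon>0$ there is a pair $(A',B')$ of complex $m\times n$ matrices with $\|A-A'\|<\varepsilon$ and $\|B-B'\|<\varepsilon$ such that $(A',B')$ is equivalent to the following pair: (i) $(I_n,\operatorname{diag}(\alpha_1,\dots,\alpha_n))$ for some $\alpha_1,\dots,\alpha_n\in\mathbb C$, if $m=n$; (ii) $([I_m\ \ 0],\,[0\ \ I_m])$, if $m<n$; (iii) $([I_n\ \ 0]^T,\,[0\ \ I_n]^T)$, if $m>n$.
   Context: Two pairs $(A_1,A_2)$ and $(B_1,B_2)$ of complex $m\times n$ matrices are equivalent if there exist nonsingular matrices $R\in\mathbb C^{m\times m}$ and $S\in\mathbb C^{n\times n}$ with $B_1=RA_1S$ and $B_2=RA_2S$. In (ii) both matrices are $m\times n$ and the zero blocks are $m\times(n-m)$; in (iii) both matrices are $m\times n$, being the transposes of $n\times m$ matrices with zero blocks of size $n\times (m-n)$. $\|\cdot\|$ is any fixed matrix norm. *)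

theory Defs
  imports Complex_Main "Jordan_Normal_Form.Matrix"
begin

text \<open>A norm on the complex vector space of \<open>m \<times> n\<close> matrices. Submultiplicativity is not
  required, so every notion of matrix norm is covered. The values of \<open>nrm\<close> outside
  \<open>carrier_mat m n\<close> are irrelevant.\<close>

definition matrix_norm :: "nat \<Rightarrow> nat \<Rightarrow> (complex mat \<Rightarrow> real) \<Rightarrow> bool" where
  "matrix_norm m n nrm \<longleftrightarrow>
     (\<forall>X \<in> carrier_mat m n. 0 \<le> nrm X) \<and>
     (\<forall>X \<in> carrier_mat m n. nrm X = 0 \<longleftrightarrow> X = 0\<^sub>m m n) \<and>
     (\<forall>c. \<forall>X \<in> carrier_mat m n. nrm (c \<cdot>\<^sub>m X) = cmod c * nrm X) \<and>
     (\<forall>X \<in> carrier_mat m n. \<forall>Y \<in> carrier_mat m n. nrm (X + Y) \<le> nrm X + nrm Y)"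

fun pair_equiv :: "nat \<Rightarrow> nat \<Rightarrow> complex mat \<times> complex mat \<Rightarrow> complex mat \<times> complex mat \<Rightarrow> bool" where
  "pair_equiv m n (A\<^sub>1, A\<^sub>2) (B\<^sub>1, B\<^sub>2) \<longleftrightarrow>
     A\<^sub>1 \<in> carrier_mat m n \<and> A\<^sub>2 \<in> carrier_mat m n \<and>
     B\<^sub>1 \<in> carrier_mat m n \<and> B\<^sub>2 \<in> carrier_mat m n \<and>
     (\<exists>R \<in> carrier_mat m m. \<exists>S \<in> carrier_mat n n.
        invertible_mat R \<and> invertible_mat S \<and>
        B\<^sub>1 = R * A\<^sub>1 * S \<and> B\<^sub>2 = R * A\<^sub>2 * S)"

text \<open>The block row \<open>[A B]\<close>, the counterpart of the library's \<^const>\<open>append_rows\<close>.\<close>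

definition append_cols :: "'a :: zero mat \<Rightarrow> 'a mat \<Rightarrow> 'a mat" (infixr \<open>@\<^sub>c\<close> 65) where
  "A @\<^sub>c B = four_block_mat A B (0\<^sub>m 0 (dim_col A)) (0\<^sub>m 0 (dim_col B))"

end

theory Submission
  imports Defs "Jordan_Normal_Form.Jordan_Normal_Form_Existence"
begin

text \<open>
  Every perturbation used is along a line and has only finitely many bad parameters. All but one of
  them replace a square block \<open>X\<close> by \<open>X + tI\<close>, which is invertible for all but finitely many \<open>t\<close>
  (\<open>finite_singular_shifts\<close>), hence for arbitrarily small \<open>t\<close> (\<open>approximable_along_line\<close>). Such steps
  are interleaved with exact equivalences. This is legitimate
  because \<open>X \<mapsto> f X\<close>, for \<open>f\<close> linear and injective, pulls a norm back to a norm; quantifying over all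
  norms at once therefore lets smallness pass through an equivalence, through the embedding of a
  subpencil as a block, and through transposition (\<open>approximable_affine_image\<close>).

  For \<open>m = n\<close>, making \<open>A\<close> invertible reduces the pair to \<open>(I, M)\<close>, on which similarity of \<open>M\<close> acts. A
  Schur form of \<open>M\<close> plus a small multiple of \<open>diag(0, \<dots>, n - 1)\<close> has distinct eigenvalues, so it is
  diagonalizable (\<open>approximable_identity_diagonal\<close>).

  For \<open>n = m + k\<close> with \<open>k > 0\<close>, making the leading \<open>m \<times> m\<close> block of \<open>A\<close> invertible reduces \<open>A\<close> to \<open>[I 0]\<close>.
  If \<open>m \<le> k\<close>, the last \<open>m\<close> columns of this \<open>A\<close> vanish, so once the last \<open>m\<close> columns of \<open>B\<close> form an
  invertible block, column operations with them turn \<open>B\<close> into \<open>[0 I]\<close> and leave \<open>A\<close> alone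
  (\<open>approximable_wide_short\<close>). If \<open>m = p + k\<close>, the last \<open>k\<close> columns of \<open>A\<close> vanish; making the trailing
  \<open>k \<times> k\<close> block of \<open>B\<close> invertible and clearing around it (\<open>approximable_via_trailing_block\<close>) gives

    \<open>A = [X 0; a 0]\<close> and \<open>B = [Y 0; 0 I]\<close>,

  where \<open>(X, Y)\<close> is a \<open>p \<times> (p + k)\<close> pencil with the same excess \<open>k\<close> of columns. By induction a small
  perturbation brings \<open>(X, Y)\<close> to \<open>([I 0], [0 I])\<close>, at the price of changing the coupling row \<open>a\<close> to some
  \<open>[b\<^sub>1 b\<^sub>2]\<close>. With \<open>b\<^sub>2\<close> invertible, again after a small perturbation, row operations make it
  \<open>[0 I]\<close>, and the damage to \<open>B\<close> is repaired through the zero columns of \<open>A\<close>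
  (\<open>pair_equiv_normalize_coupling\<close>). The result is \<open>([I 0], [0 I])\<close> of the larger size. The case
  \<open>m > n\<close> is the transpose of this one.
\<close>

section \<open>Invertible matrices\<close>

lemma invertible_mat_obtain_inverse:
  assumes "invertible_mat A" and "A \<in> carrier_mat n n"
  obtains B where "B \<in> carrier_mat n n" "A * B = 1\<^sub>m n" "B * A = 1\<^sub>m n"
proof -
  from assms obtain B where B: "A * B = 1\<^sub>m n" "B * A = 1\<^sub>m (dim_row B)"
    unfolding invertible_mat_def inverts_mat_def by auto
  have "dim_col (A * B) = n" "dim_col (B * A) = dim_row B"
    unfolding B by simp_all
  then have "B \<in> carrier_mat n n"
    using assms(2) by auto
  then show ?thesis
    using B that by auto
qed

lemma invertible_matI:
  assumes "A \<in> carrier_mat n n" "B \<in> carrier_mat n n" "A * B = 1\<^sub>m n" "B * A = 1\<^sub>m n"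
  shows "invertible_mat A"
  using assms unfolding invertible_mat_def inverts_mat_def by auto

lemma invertible_mat_iff_det_nonzero:
  fixes A :: "'a :: field mat"
  assumes "A \<in> carrier_mat n n"
  shows "invertible_mat A \<longleftrightarrow> det A \<noteq> 0"
proof
  assume "invertible_mat A"
  then obtain B where "B \<in> carrier_mat n n" "A * B = 1\<^sub>m n"
    using assms by (rule invertible_mat_obtain_inverse)
  then have "det A * det B = 1"
    using assms det_mult[of A n B] by simp
  then show "det A \<noteq> 0" by auto
next
  assume "det A \<noteq> 0"
  from det_non_zero_imp_unit[OF assms this, of "()"] show "invertible_mat A"
    using assms by (auto simp: Units_def ring_mat_def intro: invertible_matI)
qed

lemma invertible_mat_one: "invertible_mat (1\<^sub>m n :: 'a :: field mat)"
  by (simp add: invertible_mat_iff_det_nonzero[of _ n])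

lemma invertible_mat_mult:
  fixes A B :: "'a :: field mat"
  assumes "A \<in> carrier_mat n n" "B \<in> carrier_mat n n" "invertible_mat A" "invertible_mat B"
  shows "invertible_mat (A * B)"
  using assms by (simp add: invertible_mat_iff_det_nonzero[of _ n] det_mult)

lemma invertible_mat_transpose:
  fixes A :: "'a :: field mat"
  assumes "A \<in> carrier_mat n n" "invertible_mat A"
  shows "invertible_mat (transpose_mat A)"
  using assms by (simp add: invertible_mat_iff_det_nonzero[of _ n] det_transpose)

lemma invertible_mat_block_upper:
  fixes A :: "'a :: field mat"
  assumes "A \<in> carrier_mat p p" "B \<in> carrier_mat p q" "D \<in> carrier_mat q q"
    and "invertible_mat A" "invertible_mat D"
  shows "invertible_mat (four_block_mat A B (0\<^sub>m q p) D)"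
proof -
  have "det (four_block_mat A B (0\<^sub>m q p) D) = det A * det D"
    using assms by (intro det_four_block_mat_lower_left_zero) auto
  then show ?thesis
    using assms by (simp add: invertible_mat_iff_det_nonzero[of _ p]
      invertible_mat_iff_det_nonzero[of _ q] invertible_mat_iff_det_nonzero[of _ "p + q"])
qed

lemma invertible_mat_block_lower:
  fixes A :: "'a :: field mat"
  assumes "A \<in> carrier_mat p p" "C \<in> carrier_mat q p" "D \<in> carrier_mat q q"
    and "invertible_mat A" "invertible_mat D"
  shows "invertible_mat (four_block_mat A (0\<^sub>m p q) C D)"
proof -
  have "det (four_block_mat A (0\<^sub>m p q) C D) = det A * det D"
    using assms by (intro det_four_block_mat_upper_right_zero) auto
  then show ?thesis
    using assms by (simp add: invertible_mat_iff_det_nonzero[of _ p]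
      invertible_mat_iff_det_nonzero[of _ q] invertible_mat_iff_det_nonzero[of _ "p + q"])
qed

lemma mult_uminus_left_inverse:
  fixes X :: "'a :: comm_ring_1 mat"
  assumes "A \<in> carrier_mat n n" "B \<in> carrier_mat n n" "A * B = 1\<^sub>m n" "X \<in> carrier_mat n r"
  shows "A * (- (B * X)) = - X"
  using assms assoc_mult_mat[of A n n B n X r] by simp

lemma uminus_mult_right_inverse:
  fixes X :: "'a :: comm_ring_1 mat"
  assumes "A \<in> carrier_mat n n" "B \<in> carrier_mat n n" "A * B = 1\<^sub>m n" "X \<in> carrier_mat r n"
  shows "- (X * A) * B = - X"
  using assms assoc_mult_mat[of X r n A n B n] by simp

text \<open>The exceptional parameters are the negatives of the eigenvalues of \<open>A\<close>.\<close>

lemma finite_singular_shifts: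
  fixes A :: "'a :: field mat"
  assumes A: "A \<in> carrier_mat n n"
  shows "finite {t. \<not> invertible_mat (A + t \<cdot>\<^sub>m 1\<^sub>m n)}"
proof -
  have "char_poly A \<noteq> 0"
    using degree_monic_char_poly[OF A] by auto
  then have fin: "finite {k. poly (char_poly A) k = 0}"
    by (rule poly_roots_finite)
  have "- t \<in> {k. poly (char_poly A) k = 0}" if "\<not> invertible_mat (A + t \<cdot>\<^sub>m 1\<^sub>m n)" for t
  proof -
    have "det (A + t \<cdot>\<^sub>m 1\<^sub>m n) = 0"
      using that A by (simp add: invertible_mat_iff_det_nonzero[of _ n])
    then have "eigenvalue A (- t)"
      using A by (simp add: eigenvalue_det char_matrix_def)
    then show ?thesis
      using A by (simp add: eigenvalue_root_char_poly)
  qed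
  then have "{t. \<not> invertible_mat (A + t \<cdot>\<^sub>m 1\<^sub>m n)} \<subseteq> uminus ` {k. poly (char_poly A) k = 0}"
    by (auto simp: image_iff) (metis minus_minus)
  then show ?thesis
    using fin finite_surj by blast
qed

section \<open>Equivalence of matrix pairs\<close>

lemma pair_equivI:
  assumes "A\<^sub>1 \<in> carrier_mat m n" "A\<^sub>2 \<in> carrier_mat m n"
    and "R \<in> carrier_mat m m" "S \<in> carrier_mat n n" "invertible_mat R" "invertible_mat S"
    and "B\<^sub>1 = R * A\<^sub>1 * S" "B\<^sub>2 = R * A\<^sub>2 * S"
  shows "pair_equiv m n (A\<^sub>1, A\<^sub>2) (B\<^sub>1, B\<^sub>2)"
  using assms by auto

lemma pair_equiv_trans:
  assumes "pair_equiv m n (A\<^sub>1, A\<^sub>2) (B\<^sub>1, B\<^sub>2)" "pair_equiv m n (B\<^sub>1, B\<^sub>2) (C\<^sub>1, C\<^sub>2)"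
  shows "pair_equiv m n (A\<^sub>1, A\<^sub>2) (C\<^sub>1, C\<^sub>2)"
proof -
  from assms(1) obtain R S where A: "A\<^sub>1 \<in> carrier_mat m n" "A\<^sub>2 \<in> carrier_mat m n"
    and RS: "R \<in> carrier_mat m m" "S \<in> carrier_mat n n" "invertible_mat R" "invertible_mat S"
    and B: "B\<^sub>1 = R * A\<^sub>1 * S" "B\<^sub>2 = R * A\<^sub>2 * S"
    by auto
  from assms(2) obtain R' S' where
    RS': "R' \<in> carrier_mat m m" "S' \<in> carrier_mat n n" "invertible_mat R'" "invertible_mat S'"
    and C: "C\<^sub>1 = R' * B\<^sub>1 * S'" "C\<^sub>2 = R' * B\<^sub>2 * S'"
    by auto
  have eq: "R' * (R * X * S) * S' = (R' * R) * X * (S * S')" if "X \<in> carrier_mat m n" for X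
  proof -
    have "R' * (R * X * S) * S' = R' * (R * X * S * S')"
      using RS RS' that by (intro assoc_mult_mat[of _ m m _ n _ n]) auto
    also have "R * X * S * S' = R * X * (S * S')"
      using RS RS' that by (intro assoc_mult_mat[of _ m n _ n _ n]) auto
    also have "R' * \<dots> = R' * (R * X) * (S * S')"
      using RS RS' that by (intro assoc_mult_mat[symmetric, of _ m m _ n _ n]) auto
    also have "R' * (R * X) = R' * R * X"
      using RS RS' that by (intro assoc_mult_mat[symmetric, of _ m m _ m _ n]) auto
    finally show ?thesis .
  qed
  show ?thesis
  proof (rule pair_equivI[OF A, of "R' * R" "S * S'"])
    show "invertible_mat (R' * R)" "invertible_mat (S * S')"
      using RS RS' invertible_mat_mult by metis+
    show "C\<^sub>1 = R' * R * A\<^sub>1 * (S * S')" "C\<^sub>2 = R' * R * A\<^sub>2 * (S * S')"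
      unfolding C B using A by (simp_all only: eq)
  qed (use RS RS' in auto)
qed

lemma pair_equiv_obtain_reverse:
  assumes "pair_equiv m n (A\<^sub>1, A\<^sub>2) (B\<^sub>1, B\<^sub>2)"
  obtains R S where "R \<in> carrier_mat m m" "S \<in> carrier_mat n n" "invertible_mat R" "invertible_mat S"
    "A\<^sub>1 = R * B\<^sub>1 * S" "A\<^sub>2 = R * B\<^sub>2 * S"
proof -
  from assms obtain R S where A: "A\<^sub>1 \<in> carrier_mat m n" "A\<^sub>2 \<in> carrier_mat m n"
    and RS: "R \<in> carrier_mat m m" "S \<in> carrier_mat n n" "invertible_mat R" "invertible_mat S"
    and B: "B\<^sub>1 = R * A\<^sub>1 * S" "B\<^sub>2 = R * A\<^sub>2 * S"
    by auto
  obtain R' where R': "R' \<in> carrier_mat m m" "R * R' = 1\<^sub>m m" "R' * R = 1\<^sub>m m"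
    using RS by (metis invertible_mat_obtain_inverse)
  obtain S' where S': "S' \<in> carrier_mat n n" "S * S' = 1\<^sub>m n" "S' * S = 1\<^sub>m n"
    using RS by (metis invertible_mat_obtain_inverse)
  have eq: "X = R' * (R * X * S) * S'" if X: "X \<in> carrier_mat m n" for X
  proof -
    have "R' * (R * X * S) * S' = R' * (R * X * S * S')"
      using RS R' S' that by (intro assoc_mult_mat[of _ m m _ n _ n]) auto
    also have "R * X * S * S' = R * X * (S * S')"
      using RS R' S' that by (intro assoc_mult_mat[of _ m n _ n _ n]) auto
    also have "\<dots> = R * X"
      using RS X S' by simp
    also have "R' * (R * X) = R' * R * X"
      using RS R' S' that by (intro assoc_mult_mat[symmetric, of _ m m _ m _ n]) auto
    also have "\<dots> = X"
      using R' X by simp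
    finally show ?thesis by simp
  qed
  have "invertible_mat R'" "invertible_mat S'"
    using R' S' RS invertible_matI by metis+
  then show ?thesis
    using that[of R' S'] R' S' eq[OF A(1)] eq[OF A(2)] unfolding B by auto
qed

declare pair_equiv.simps [simp del]

section \<open>Approximation by pairs with a given property\<close>

text \<open>Every norm is allowed, not just one fixed norm: all norms on the space are equivalent, so the
  meaning is the same, but this form transfers along injective linear maps without any comparison
  of norms.\<close>

definition approximable ::
  "nat \<Rightarrow> nat \<Rightarrow> (complex mat \<Rightarrow> complex mat \<Rightarrow> bool) \<Rightarrow> complex mat \<Rightarrow> complex mat \<Rightarrow> bool" where
  "approximable m n P A B \<longleftrightarrow> A \<in> carrier_mat m n \<and> B \<in> carrier_mat m n \<and>
     (\<forall>nrm \<epsilon>. matrix_norm m n nrm \<longrightarrow> \<epsilon> > 0 \<longrightarrow>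
       (\<exists>A' \<in> carrier_mat m n. \<exists>B' \<in> carrier_mat m n.
          nrm (A - A') < \<epsilon> \<and> nrm (B - B') < \<epsilon> \<and> P A' B'))"

lemma approximable_carrier:
  assumes "approximable m n P A B"
  shows "A \<in> carrier_mat m n" "B \<in> carrier_mat m n"
  using assms unfolding approximable_def by auto

lemma approximable_trans:
  assumes "approximable m n P A B"
    and PQ: "\<And>X Y. X \<in> carrier_mat m n \<Longrightarrow> Y \<in> carrier_mat m n \<Longrightarrow> P X Y \<Longrightarrow> approximable m n Q X Y"
  shows "approximable m n Q A B"
  unfolding approximable_def
proof (intro conjI allI impI)
  show A: "A \<in> carrier_mat m n" and B: "B \<in> carrier_mat m n"
    using assms(1) by (rule approximable_carrier)+
  fix nrm :: "complex mat \<Rightarrow> real" and \<epsilon> :: real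
  assume N: "matrix_norm m n nrm" and e: "\<epsilon> > 0"
  then have e2: "\<epsilon> / 2 > 0" by simp
  from assms(1) N e2 obtain X Y where X: "X \<in> carrier_mat m n" "Y \<in> carrier_mat m n"
    "nrm (A - X) < \<epsilon> / 2" "nrm (B - Y) < \<epsilon> / 2" "P X Y"
    unfolding approximable_def by blast
  from PQ[OF X(1,2,5)] N e2 obtain X' Y' where X': "X' \<in> carrier_mat m n" "Y' \<in> carrier_mat m n"
    "nrm (X - X') < \<epsilon> / 2" "nrm (Y - Y') < \<epsilon> / 2" "Q X' Y'"
    unfolding approximable_def by blast
  have tri: "nrm (U - W) \<le> nrm (U - V) + nrm (V - W)"
    if "U \<in> carrier_mat m n" "V \<in> carrier_mat m n" "W \<in> carrier_mat m n" for U V W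
  proof -
    have "U - W = (U - V) + (V - W)"
      using that by (intro eq_matI) auto
    then show ?thesis
      using N that unfolding matrix_norm_def by (metis minus_carrier_mat)
  qed
  show "\<exists>A' \<in> carrier_mat m n. \<exists>B' \<in> carrier_mat m n.
      nrm (A - A') < \<epsilon> \<and> nrm (B - B') < \<epsilon> \<and> Q A' B'"
    using tri[OF A X(1) X'(1)] tri[OF B X(2) X'(2)] X X'
    by (intro bexI[of _ X'] bexI[of _ Y'] conjI) auto
qed

text \<open>Parameters \<open>t\<close> of modulus below any positive bound form an infinite set, so finitely many
  exceptions can be avoided.\<close>

lemma approximable_along_line:
  assumes A: "A \<in> carrier_mat m n" and B: "B \<in> carrier_mat m n"
    and C: "C \<in> carrier_mat m n" and D: "D \<in> carrier_mat m n"
    and fin: "finite {t. \<not> good t}"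
    and good: "\<And>t. good t \<Longrightarrow> P (A + t \<cdot>\<^sub>m C) (B + t \<cdot>\<^sub>m D)"
  shows "approximable m n P A B"
  unfolding approximable_def
proof (intro conjI allI impI A B)
  fix nrm :: "complex mat \<Rightarrow> real" and \<epsilon> :: real
  assume N: "matrix_norm m n nrm" and e: "\<epsilon> > 0"
  have nn: "nrm C \<ge> 0" "nrm D \<ge> 0"
    using N C D unfolding matrix_norm_def by auto
  define \<delta> where "\<delta> = \<epsilon> / (nrm C + nrm D + 1)"
  have d: "\<delta> > 0"
    using e nn unfolding \<delta>_def by (auto intro!: divide_pos_pos)
  then have "infinite {0<..<\<delta>}"
    by simp
  then have "infinite (complex_of_real ` {0<..<\<delta>})"
    by (subst finite_image_iff) (auto simp: inj_on_def)
  then have "\<not> complex_of_real ` {0<..<\<delta>} \<subseteq> {t. \<not> good t}"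
    using fin finite_subset by blast
  then obtain t where "t \<in> complex_of_real ` {0<..<\<delta>}" and t: "P (A + t \<cdot>\<^sub>m C) (B + t \<cdot>\<^sub>m D)"
    using good by blast
  then have td: "cmod t < \<delta>"
    by auto
  have dist: "nrm (X - (X + t \<cdot>\<^sub>m Z)) < \<epsilon>"
    if "X \<in> carrier_mat m n" "Z \<in> carrier_mat m n" "nrm Z \<ge> 0" "nrm Z \<le> nrm C + nrm D" for X Z
  proof -
    have "X - (X + t \<cdot>\<^sub>m Z) = (- t) \<cdot>\<^sub>m Z"
      using that by (intro eq_matI) auto
    then have "nrm (X - (X + t \<cdot>\<^sub>m Z)) = cmod t * nrm Z"
      using N that unfolding matrix_norm_def by simp
    also have "\<dots> \<le> \<delta> * nrm Z"
      using td that by (intro mult_right_mono) auto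
    also have "\<dots> < \<delta> * (nrm C + nrm D + 1)"
      using d that by (intro mult_strict_left_mono) auto
    also have "\<dots> = \<epsilon>"
      using nn unfolding \<delta>_def by (simp add: add_nonneg_eq_0_iff)
    finally show ?thesis .
  qed
  show "\<exists>A' \<in> carrier_mat m n. \<exists>B' \<in> carrier_mat m n.
      nrm (A - A') < \<epsilon> \<and> nrm (B - B') < \<epsilon> \<and> P A' B'"
    using A B C D t nn dist
    by (intro bexI[of _ "A + t \<cdot>\<^sub>m C"] bexI[of _ "B + t \<cdot>\<^sub>m D"]) auto
qed

text \<open>The composite of a norm with the linear injection \<open>f\<close> is again a norm, and in it the distance
  of \<open>X\<close> and \<open>Y\<close> is that of \<open>\<phi> X\<close> and \<open>\<phi> Y\<close>. The two affine maps \<open>\<phi>\<close> and \<open>\<psi>\<close> share their linear part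
  but may differ in the constant part; the embedding of a subpencil into a block pencil needs this.\<close>

lemma approximable_affine_image:
  assumes appr: "approximable p q P A B"
    and lin: "\<And>X. X \<in> carrier_mat p q \<Longrightarrow> f X \<in> carrier_mat m n"
      "\<And>X Y. X \<in> carrier_mat p q \<Longrightarrow> Y \<in> carrier_mat p q \<Longrightarrow> f (X + Y) = f X + f Y"
      "\<And>c X. X \<in> carrier_mat p q \<Longrightarrow> f (c \<cdot>\<^sub>m X) = c \<cdot>\<^sub>m f X"
      "\<And>X. X \<in> carrier_mat p q \<Longrightarrow> f X = 0\<^sub>m m n \<Longrightarrow> X = 0\<^sub>m p q"
    and \<phi>: "\<And>X. X \<in> carrier_mat p q \<Longrightarrow> \<phi> X \<in> carrier_mat m n"
      "\<And>X Y. X \<in> carrier_mat p q \<Longrightarrow> Y \<in> carrier_mat p q \<Longrightarrow> \<phi> X - \<phi> Y = f (X - Y)"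
    and \<psi>: "\<And>X. X \<in> carrier_mat p q \<Longrightarrow> \<psi> X \<in> carrier_mat m n"
      "\<And>X Y. X \<in> carrier_mat p q \<Longrightarrow> Y \<in> carrier_mat p q \<Longrightarrow> \<psi> X - \<psi> Y = f (X - Y)"
    and Q: "\<And>X Y. X \<in> carrier_mat p q \<Longrightarrow> Y \<in> carrier_mat p q \<Longrightarrow> P X Y \<Longrightarrow> Q (\<phi> X) (\<psi> Y)"
  shows "approximable m n Q (\<phi> A) (\<psi> B)"
  unfolding approximable_def
proof (intro conjI allI impI)
  have A: "A \<in> carrier_mat p q" and B: "B \<in> carrier_mat p q"
    using appr by (rule approximable_carrier)+
  then show "\<phi> A \<in> carrier_mat m n" "\<psi> B \<in> carrier_mat m n"
    using \<phi> \<psi> by auto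
  fix nrm :: "complex mat \<Rightarrow> real" and \<epsilon> :: real
  assume N: "matrix_norm m n nrm" and e: "\<epsilon> > 0"
  have f0: "f (0\<^sub>m p q) = 0\<^sub>m m n"
  proof -
    have "0\<^sub>m p q = 0 \<cdot>\<^sub>m (0\<^sub>m p q :: complex mat)"
      by auto
    then have "f (0\<^sub>m p q) = 0 \<cdot>\<^sub>m f (0\<^sub>m p q)"
      using lin(3)[of "0\<^sub>m p q" 0] by simp
    also have "\<dots> = 0\<^sub>m m n"
      using lin(1)[of "0\<^sub>m p q"] by (intro eq_matI) auto
    finally show ?thesis .
  qed
  have "matrix_norm p q (\<lambda>X. nrm (f X))"
    using N lin f0 unfolding matrix_norm_def by auto
  then obtain A' B' where "A' \<in> carrier_mat p q" "B' \<in> carrier_mat p q"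
    "nrm (f (A - A')) < \<epsilon>" "nrm (f (B - B')) < \<epsilon>" "P A' B'"
    using appr e unfolding approximable_def by blast
  then show "\<exists>A' \<in> carrier_mat m n. \<exists>B' \<in> carrier_mat m n.
      nrm (\<phi> A - A') < \<epsilon> \<and> nrm (\<psi> B - B') < \<epsilon> \<and> Q A' B'"
    using A B \<phi> \<psi> Q by (intro bexI[of _ "\<phi> A'"] bexI[of _ "\<psi> B'"]) auto
qed

definition equivalence_closed :: "nat \<Rightarrow> nat \<Rightarrow> (complex mat \<Rightarrow> complex mat \<Rightarrow> bool) \<Rightarrow> bool" where
  "equivalence_closed m n P \<longleftrightarrow>
     (\<forall>A B A' B'. pair_equiv m n (A, B) (A', B') \<longrightarrow> P A' B' \<longrightarrow> P A B)"

lemma equivalence_closed_class: "equivalence_closed m n (\<lambda>X Y. pair_equiv m n (X, Y) (C, D))"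
  unfolding equivalence_closed_def using pair_equiv_trans by blast

text \<open>Multiplication by invertible matrices is a linear injection, which leaves the property unchanged.\<close>

lemma approximable_pair_equiv:
  assumes closed: "equivalence_closed m n P"
    and equiv: "pair_equiv m n (A, B) (A', B')" and appr: "approximable m n P A' B'"
  shows "approximable m n P A B"
proof -
  obtain R S where RS: "R \<in> carrier_mat m m" "S \<in> carrier_mat n n" "invertible_mat R" "invertible_mat S"
    and AB: "A = R * A' * S" "B = R * B' * S"
    using pair_equiv_obtain_reverse[OF equiv] by metis
  have carr: "R * X * S \<in> carrier_mat m n" if "X \<in> carrier_mat m n" for X
    using RS that by simp
  have e: "pair_equiv m n (X, Y) (R * X * S, R * Y * S)"
    if "X \<in> carrier_mat m n" "Y \<in> carrier_mat m n" for X Y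
    using RS that by (intro pair_equivI[of _ _ _ _ R S]) auto
  have equiv_rev: "pair_equiv m n (R * X * S, R * Y * S) (X, Y)"
    if XY: "X \<in> carrier_mat m n" "Y \<in> carrier_mat m n" for X Y
  proof -
    obtain R' S' where "R' \<in> carrier_mat m m" "S' \<in> carrier_mat n n" "invertible_mat R'" "invertible_mat S'"
      "X = R' * (R * X * S) * S'" "Y = R' * (R * Y * S) * S'"
      using pair_equiv_obtain_reverse[OF e[OF XY]] by metis
    then show ?thesis
      using pair_equivI[OF carr[OF XY(1)] carr[OF XY(2)]] by blast
  qed
  have diff: "R * X * S - R * Y * S = R * (X - Y) * S"
    if "X \<in> carrier_mat m n" "Y \<in> carrier_mat m n" for X Y
    using RS that by (simp add: mult_minus_distrib_mat[of _ m m _ n] minus_mult_distrib_mat[of _ m n _ _ n])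
  have zero: "X = 0\<^sub>m m n" if X: "X \<in> carrier_mat m n" and "R * X * S = 0\<^sub>m m n" for X
  proof -
    obtain R' S' where "R' \<in> carrier_mat m m" "S' \<in> carrier_mat n n" "X = R' * (R * X * S) * S'"
      using pair_equiv_obtain_reverse[OF e[OF X X]] by metis
    then show ?thesis
      using that by simp
  qed
  show ?thesis
    unfolding AB
  proof (rule approximable_affine_image[OF appr, where f = "\<lambda>X. R * X * S"])
    show "P (R * X * S) (R * Y * S)" if "X \<in> carrier_mat m n" "Y \<in> carrier_mat m n" "P X Y" for X Y
      using closed equiv_rev that unfolding equivalence_closed_def by blast
    show "R * (X + Y) * S = R * X * S + R * Y * S"
      if "X \<in> carrier_mat m n" "Y \<in> carrier_mat m n" for X Y
      using RS that by (simp add: mult_add_distrib_mat[of _ m m _ n] add_mult_distrib_mat[of _ m n _ _ n])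
    show "R * (c \<cdot>\<^sub>m X) * S = c \<cdot>\<^sub>m (R * X * S)" if "X \<in> carrier_mat m n" for c X
      using RS that by (simp add: mult_smult_distrib[of _ m m _ n] mult_smult_assoc_mat[of _ m n _ n])
  qed (use carr diff zero in auto)
qed

section \<open>Square pencils\<close>

lemma order_linear_factors:
  "order a (\<Prod>x\<leftarrow>xs. [:- x, 1 :: 'a :: field:]) = count_list xs a"
proof (induction xs)
  case (Cons x xs)
  have "order a ([:- x, 1:] * (\<Prod>x\<leftarrow>xs. [:- x, 1:])) =
      order a [:- x, 1:] + order a (\<Prod>x\<leftarrow>xs. [:- x, 1:])"
    by (rule order_mult) (auto simp: prod_list_zero_iff simp del: mult_pCons_left)
  also have "order a [:- x, 1:] = (if x = a then 1 else 0)"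
    using order_linear_power[of a "- x" 1] by auto
  finally show ?case
    using Cons.IH by simp
qed simp

lemma jordan_matrix_simple:
  assumes "\<forall>na \<in> set n_as. fst na = 1"
  shows "jordan_matrix n_as = mat_diag (length n_as) (\<lambda>i. snd (n_as ! i))"
  using assms
proof (induction n_as)
  case Nil
  show ?case
    by (simp add: jordan_matrix_def mat_diag_def) (auto intro!: eq_matI)
next
  case (Cons na n_as)
  obtain a where na: "na = (1, a)"
    using Cons.prems by (cases na) auto
  have "map fst n_as = replicate (length n_as) 1"
    using Cons.prems by (intro replicate_eqI) auto
  then have len: "sum_list (map fst n_as) = length n_as"
    by (simp add: sum_list_replicate)
  show ?case
    unfolding na jordan_matrix_Cons len using Cons
    by (intro eq_matI) (auto simp: mat_diag_def nth_Cons' jordan_block_def)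
qed

text \<open>The sizes of the Jordan blocks with eigenvalue \<open>a\<close> add up to the multiplicity of \<open>a\<close> in the
  characteristic polynomial. For a triangular matrix this is the number of occurrences of \<open>a\<close> on the
  diagonal, so here every block has size 1.\<close>

lemma similar_mat_diag_if_distinct:
  fixes T :: "complex mat"
  assumes T: "T \<in> carrier_mat n n" "upper_triangular T" and dist: "distinct (diag_mat T)"
  obtains \<alpha> where "similar_mat T (mat_diag n \<alpha>)"
proof -
  have cp: "char_poly T = (\<Prod>a\<leftarrow>diag_mat T. [:- a, 1:])"
    using T by (rule char_poly_upper_triangular)
  then obtain n_as where jnf: "jordan_nf T n_as"
    using jordan_nf_exists[OF T(1)] by blast
  have "fst na = 1" if na: "na \<in> set n_as" for na
  proof -
    have "fst na \<le> sum_list (map fst (filter (\<lambda>nb. snd nb = snd na) n_as))"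
      using na by (intro member_le_sum_list) auto
    also have "\<dots> = count_list (diag_mat T) (snd na)"
      using jordan_nf_order[OF jnf, of "snd na"] unfolding cp order_linear_factors by simp
    also have "\<dots> \<le> 1"
    proof -
      have "count_list xs a \<le> 1" if "distinct xs" for xs and a :: complex
        using that by (induction xs) (auto simp: count_notin)
      then show ?thesis
        using dist by blast
    qed
    finally show ?thesis
      using jnf na unfolding jordan_nf_def by (cases "fst na") force+
  qed
  then have sim: "similar_mat T (mat_diag (length n_as) (\<lambda>i. snd (n_as ! i)))"
    using jnf jordan_matrix_simple unfolding jordan_nf_def by metis
  moreover have "length n_as = n"
  proof -
    obtain n' P Q where "{T, mat_diag (length n_as) (\<lambda>i. snd (n_as ! i)), P, Q} \<subseteq> carrier_mat n' n'"
      using similar_matD[OF sim] by metis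
    then have "dim_row T = n'" "dim_row (mat_diag (length n_as) (\<lambda>i. snd (n_as ! i))) = n'"
      by blast+
    then show ?thesis
      using T by (simp add: mat_diag_def)
  qed
  ultimately show ?thesis
    using that by blast
qed

lemma pair_equiv_one_similar:
  assumes "similar_mat M T" "M \<in> carrier_mat n n"
  shows "pair_equiv n n (1\<^sub>m n, M) (1\<^sub>m n, T)"
proof -
  obtain P Q where PQ: "{M, T, P, Q} \<subseteq> carrier_mat n n" "P * Q = 1\<^sub>m n" "Q * P = 1\<^sub>m n" "M = P * T * Q"
    using similar_matD[OF assms(1)] assms(2) by (metis carrier_matD(1) insert_subset)
  show ?thesis
  proof (rule pair_equivI[of _ _ _ _ Q P])
    have "Q * (P * T * Q) * P = Q * (P * T * Q * P)"
      using PQ by (intro assoc_mult_mat[of _ n n _ n _ n]) auto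
    also have "P * T * Q * P = P * T * (Q * P)"
      using PQ by (intro assoc_mult_mat[of _ n n _ n _ n]) auto
    also have "\<dots> = P * T"
      using PQ by auto
    also have "Q * (P * T) = Q * P * T"
      using PQ by (intro assoc_mult_mat[symmetric, of _ n n _ n _ n]) auto
    also have "\<dots> = T"
      using PQ by auto
    finally show "T = Q * M * P"
      using PQ by simp
    show "invertible_mat Q" "invertible_mat P"
      using PQ invertible_matI by (metis insert_subset)+
  qed (use PQ in auto)
qed

text \<open>Two diagonal entries coincide for at most one \<open>t\<close>, since they move at different speeds.\<close>

lemma finite_repeated_diagonal:
  fixes T :: "complex mat"
  assumes T: "T \<in> carrier_mat n n"
  shows "finite {t. \<not> distinct (diag_mat (T + t \<cdot>\<^sub>m mat_diag n of_nat))}"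
proof (rule finite_subset)
  let ?c = "\<lambda>(i, j). (T $$ (i, i) - T $$ (j, j)) / (of_nat j - of_nat i)"
  show "{t. \<not> distinct (diag_mat (T + t \<cdot>\<^sub>m mat_diag n of_nat))} \<subseteq> ?c ` ({..<n} \<times> {..<n})"
  proof
    fix t
    assume "t \<in> {t. \<not> distinct (diag_mat (T + t \<cdot>\<^sub>m mat_diag n of_nat))}"
    then obtain i j where ij: "i < n" "j < n" "i \<noteq> j"
      "T $$ (i, i) + t * of_nat i = T $$ (j, j) + t * of_nat j"
      using T by (auto simp: distinct_conv_nth diag_mat_def mat_diag_def)
    then have "t * (of_nat j - of_nat i) = T $$ (i, i) - T $$ (j, j)"
      by (simp add: algebra_simps)
    then have "t = ?c (i, j)"
      using ij by (simp add: field_simps)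
    then show "t \<in> ?c ` ({..<n} \<times> {..<n})"
      using ij by blast
  qed
qed simp

text \<open>The pair \<open>(I, M)\<close> is equivalent to \<open>(I, T)\<close> for every \<open>T\<close> similar to \<open>M\<close>, so \<open>M\<close> may be taken
  triangular. Then the eigenvalues stand on the diagonal and a diagonal perturbation separates them.\<close>

lemma approximable_identity_diagonal:
  assumes A: "A \<in> carrier_mat n n" and B: "B \<in> carrier_mat n n"
  shows "approximable n n (\<lambda>X Y. \<exists>\<alpha>. pair_equiv n n (X, Y) (1\<^sub>m n, mat_diag n \<alpha>)) A B"
    (is "approximable n n ?P A B")
proof -
  have closed: "equivalence_closed n n ?P"
    unfolding equivalence_closed_def using pair_equiv_trans by blast
  have triangular: "approximable n n ?P (1\<^sub>m n) T"
    if T: "T \<in> carrier_mat n n" "upper_triangular T" for T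
  proof (rule approximable_along_line[of _ n n _ "0\<^sub>m n n" "mat_diag n of_nat",
        OF _ _ _ _ finite_repeated_diagonal[OF T(1)]])
    show "?P (1\<^sub>m n + t \<cdot>\<^sub>m 0\<^sub>m n n) (T + t \<cdot>\<^sub>m mat_diag n of_nat)"
      if dist: "distinct (diag_mat (T + t \<cdot>\<^sub>m mat_diag n of_nat))" for t
    proof -
      let ?T = "T + t \<cdot>\<^sub>m mat_diag n of_nat"
      have c: "?T \<in> carrier_mat n n"
        using T by simp
      have "upper_triangular ?T"
        using T by (auto simp: upper_triangular_def mat_diag_def)
      then obtain \<alpha> where "similar_mat ?T (mat_diag n \<alpha>)"
        using similar_mat_diag_if_distinct[OF c _ dist] by blast
      moreover have "1\<^sub>m n + t \<cdot>\<^sub>m 0\<^sub>m n n = (1\<^sub>m n :: complex mat)"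
        by (intro eq_matI) auto
      ultimately show ?thesis
        using pair_equiv_one_similar[OF _ c] by auto
    qed
  qed (use T in auto)
  have monic: "approximable n n ?P (1\<^sub>m n) M" if M: "M \<in> carrier_mat n n" for M
  proof -
    obtain es where "char_poly M = (\<Prod>a\<leftarrow>es. [:- a, 1:])"
      using char_poly_factorized[OF M] by blast
    then obtain T where "T \<in> carrier_mat n n" "upper_triangular T" "similar_mat M T"
      using schur_decomposition_exists[OF M] by blast
    then show ?thesis
      using approximable_pair_equiv[OF closed pair_equiv_one_similar[OF _ M] triangular] by simp
  qed
  have "approximable n n (\<lambda>X Y. invertible_mat X) A B"
    using A B
    by (intro approximable_along_line[of _ n n _ "1\<^sub>m n" "0\<^sub>m n n", OF _ _ _ _ finite_singular_shifts[OF A]])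
      auto
  then show ?thesis
  proof (rule approximable_trans)
    fix X Y :: "complex mat"
    assume X: "X \<in> carrier_mat n n" and Y: "Y \<in> carrier_mat n n" and "invertible_mat X"
    then obtain X' where X': "X' \<in> carrier_mat n n" "X * X' = 1\<^sub>m n" "X' * X = 1\<^sub>m n"
      by (metis invertible_mat_obtain_inverse)
    have "pair_equiv n n (X, Y) (1\<^sub>m n, X' * Y)"
      using X Y X' invertible_matI[OF X'(1) X X'(3) X'(2)]
      by (intro pair_equivI[of _ _ _ _ X' "1\<^sub>m n"]) (auto simp: invertible_mat_one)
    moreover have "approximable n n ?P (1\<^sub>m n) (X' * Y)"
      using X' Y by (intro monic) simp
    ultimately show "approximable n n ?P X Y"
      by (rule approximable_pair_equiv[OF closed])
  qed
qed

section \<open>Block rows\<close>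

abbreviation one_zero :: "nat \<Rightarrow> nat \<Rightarrow> complex mat" where
  "one_zero m k \<equiv> 1\<^sub>m m @\<^sub>c 0\<^sub>m m k"

abbreviation zero_one :: "nat \<Rightarrow> nat \<Rightarrow> complex mat" where
  "zero_one m k \<equiv> 0\<^sub>m m k @\<^sub>c 1\<^sub>m m"

lemma append_cols_carrier [simp]:
  assumes "X \<in> carrier_mat m p" "Y \<in> carrier_mat m q"
  shows "X @\<^sub>c Y \<in> carrier_mat m (p + q)"
  using assms unfolding append_cols_def by auto

lemma one_zero_carrier [simp]: "one_zero m k \<in> carrier_mat m (m + k)"
  by simp

lemma zero_one_carrier [simp]: "zero_one m k \<in> carrier_mat m (m + k)"
  using append_cols_carrier[of "0\<^sub>m m k" m k "1\<^sub>m m" m] by (simp add: add.commute)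

lemma append_cols_split:
  assumes "X \<in> carrier_mat m (p + q)"
  obtains Y Z where "Y \<in> carrier_mat m p" "Z \<in> carrier_mat m q" "X = Y @\<^sub>c Z"
proof (rule that)
  show "X = mat m p (\<lambda>(i, j). X $$ (i, j)) @\<^sub>c mat m q (\<lambda>(i, j). X $$ (i, p + j))"
    using assms unfolding append_cols_def by (intro eq_matI) auto
qed auto

lemma append_cols_add_smult:
  assumes "X \<in> carrier_mat m p" "X' \<in> carrier_mat m p" "Y \<in> carrier_mat m q" "Y' \<in> carrier_mat m q"
  shows "(X @\<^sub>c Y) + t \<cdot>\<^sub>m (X' @\<^sub>c Y') = (X + t \<cdot>\<^sub>m X') @\<^sub>c (Y + t \<cdot>\<^sub>m Y')"
  using assms unfolding append_cols_def by (intro eq_matI) auto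

lemma append_cols_add:
  assumes "X \<in> carrier_mat m p" "X' \<in> carrier_mat m p" "Y \<in> carrier_mat m q" "Y' \<in> carrier_mat m q"
  shows "(X @\<^sub>c Y) + (X' @\<^sub>c Y') = (X + X') @\<^sub>c (Y + Y')"
  using assms unfolding append_cols_def by (intro eq_matI) auto

lemma append_cols_mult_block:
  fixes X :: "'a :: semiring_0 mat"
  assumes "X \<in> carrier_mat m p" "Y \<in> carrier_mat m q"
    and "S\<^sub>1 \<in> carrier_mat p r" "S\<^sub>2 \<in> carrier_mat p s" "S\<^sub>3 \<in> carrier_mat q r" "S\<^sub>4 \<in> carrier_mat q s"
  shows "(X @\<^sub>c Y) * four_block_mat S\<^sub>1 S\<^sub>2 S\<^sub>3 S\<^sub>4 = (X * S\<^sub>1 + Y * S\<^sub>3) @\<^sub>c (X * S\<^sub>2 + Y * S\<^sub>4)"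
proof -
  have "(X @\<^sub>c Y) * four_block_mat S\<^sub>1 S\<^sub>2 S\<^sub>3 S\<^sub>4 =
    four_block_mat (X * S\<^sub>1 + Y * S\<^sub>3) (X * S\<^sub>2 + Y * S\<^sub>4)
      (0\<^sub>m 0 p * S\<^sub>1 + 0\<^sub>m 0 q * S\<^sub>3) (0\<^sub>m 0 p * S\<^sub>2 + 0\<^sub>m 0 q * S\<^sub>4)"
    using assms unfolding append_cols_def by (subst mult_four_block_mat[of _ m p _ q _ 0]) auto
  then show ?thesis
    using assms unfolding append_cols_def by simp
qed

lemma mult_append_cols:
  fixes X :: "'a :: semiring_0 mat"
  assumes "M \<in> carrier_mat r m" "X \<in> carrier_mat m p" "Y \<in> carrier_mat m q"
  shows "M * (X @\<^sub>c Y) = (M * X) @\<^sub>c (M * Y)"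
proof -
  have "col (X @\<^sub>c Y) j = (if j < p then col X j else col Y (j - p))" if "j < p + q" for j
    using assms that unfolding append_cols_def by (intro eq_vecI) auto
  then show ?thesis
    using assms by (intro eq_matI) (auto simp: append_cols_def)
qed

section \<open>Wide pencils\<close>

text \<open>Once \<open>X\<^sub>1\<close> is invertible, column operations turn \<open>[X\<^sub>1 X\<^sub>2]\<close> into \<open>[I 0]\<close>. The second matrix
  of the pencil changes uncontrollably, hence the quantification over all \<open>Y\<close>.\<close>

lemma approximable_via_leading_block:
  assumes closed: "equivalence_closed m (m + k) P"
    and A: "A \<in> carrier_mat m (m + k)" and B: "B \<in> carrier_mat m (m + k)"
    and norm: "\<And>Y. Y \<in> carrier_mat m (m + k) \<Longrightarrow> approximable m (m + k) P (one_zero m k) Y"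
  shows "approximable m (m + k) P A B"
proof -
  obtain A\<^sub>1 A\<^sub>2 where A12: "A\<^sub>1 \<in> carrier_mat m m" "A\<^sub>2 \<in> carrier_mat m k" "A = A\<^sub>1 @\<^sub>c A\<^sub>2"
    using append_cols_split[OF A] by blast
  let ?P = "\<lambda>X Y. \<exists>X\<^sub>1 \<in> carrier_mat m m. \<exists>X\<^sub>2 \<in> carrier_mat m k. invertible_mat X\<^sub>1 \<and> X = X\<^sub>1 @\<^sub>c X\<^sub>2"
  have "approximable m (m + k) ?P A B"
  proof (rule approximable_along_line[of _ m "m + k" _ "one_zero m k" "0\<^sub>m m (m + k)",
        OF _ _ _ _ finite_singular_shifts[OF A12(1)]])
    show "?P (A + t \<cdot>\<^sub>m one_zero m k) Y" if "invertible_mat (A\<^sub>1 + t \<cdot>\<^sub>m 1\<^sub>m m)" for t and Y :: "complex mat"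
      using A12 that by (intro bexI[of _ "A\<^sub>1 + t \<cdot>\<^sub>m 1\<^sub>m m"] bexI[of _ "A\<^sub>2 + t \<cdot>\<^sub>m 0\<^sub>m m k"])
        (auto simp: append_cols_add_smult)
  qed (use A B in auto)
  then show ?thesis
  proof (rule approximable_trans)
    fix X Y :: "complex mat"
    assume X: "X \<in> carrier_mat m (m + k)" and Y: "Y \<in> carrier_mat m (m + k)" and "?P X Y"
    then obtain X\<^sub>1 X\<^sub>2 where X12: "X\<^sub>1 \<in> carrier_mat m m" "X\<^sub>2 \<in> carrier_mat m k"
      "invertible_mat X\<^sub>1" "X = X\<^sub>1 @\<^sub>c X\<^sub>2" by blast
    then obtain Z where Z: "Z \<in> carrier_mat m m" "X\<^sub>1 * Z = 1\<^sub>m m" "Z * X\<^sub>1 = 1\<^sub>m m"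
      by (metis invertible_mat_obtain_inverse)
    define S where "S = four_block_mat Z (- (Z * X\<^sub>2)) (0\<^sub>m k m) (1\<^sub>m k)"
    have S: "S \<in> carrier_mat (m + k) (m + k)"
      using X12 Z unfolding S_def by auto
    have iS: "invertible_mat S"
      unfolding S_def using X12 Z invertible_matI[OF Z(1) X12(1) Z(3) Z(2)]
      by (intro invertible_mat_block_upper) (auto simp: invertible_mat_one)
    have "X\<^sub>1 * (- (Z * X\<^sub>2)) = - X\<^sub>2"
      using X12 Z by (intro mult_uminus_left_inverse) auto
    moreover have "- X\<^sub>2 + X\<^sub>2 = 0\<^sub>m m k"
      using X12 by (intro eq_matI) auto
    ultimately have "X * S = one_zero m k"
      using X12 Z unfolding S_def X12(4) by (subst append_cols_mult_block[of _ m m _ k _ m _ k]) auto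
    then have "pair_equiv m (m + k) (X, Y) (one_zero m k, Y * S)"
      using X Y S iS by (intro pair_equivI[of _ _ _ _ "1\<^sub>m m" S]) (auto simp: invertible_mat_one)
    moreover have "approximable m (m + k) P (one_zero m k) (Y * S)"
      using Y S by (intro norm) simp
    ultimately show "approximable m (m + k) P X Y"
      by (rule approximable_pair_equiv[OF closed])
  qed
qed

text \<open>For \<open>m \<le> k\<close> the unit block of \<open>[I 0]\<close> fits into the first \<open>k\<close> columns. The last \<open>m\<close> columns are
  then free to be used for eliminating \<open>B\<close>.\<close>

lemma approximable_wide_short:
  assumes le: "m \<le> k" and B: "B \<in> carrier_mat m (m + k)"
  shows "approximable m (m + k) (\<lambda>X Y. pair_equiv m (m + k) (X, Y) (one_zero m k, zero_one m k))
    (one_zero m k) B"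
    (is "approximable m (m + k) ?P _ _")
proof -
  have B': "B \<in> carrier_mat m (k + m)"
    using B by (simp add: add.commute)
  obtain G H where GH: "G \<in> carrier_mat m k" "H \<in> carrier_mat m m" "B = G @\<^sub>c H"
    using append_cols_split[OF B'] by blast
  define E where "E = (mat m k (\<lambda>(i, j). if i = j then 1 else 0) :: complex mat)"
  have E: "E \<in> carrier_mat m k"
    unfolding E_def by simp
  have one_zero: "one_zero m k = E @\<^sub>c 0\<^sub>m m m"
    using le unfolding E_def append_cols_def by (intro eq_matI) auto
  show ?thesis
  proof (rule approximable_along_line[of _ m "m + k" _ "0\<^sub>m m (m + k)" "zero_one m k",
        OF _ _ _ _ finite_singular_shifts[OF GH(2)]])
    show "?P (one_zero m k + t \<cdot>\<^sub>m 0\<^sub>m m (m + k)) (B + t \<cdot>\<^sub>m zero_one m k)"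
      if "invertible_mat (H + t \<cdot>\<^sub>m 1\<^sub>m m)" for t
    proof -
      define K where "K = H + t \<cdot>\<^sub>m 1\<^sub>m m"
      have K: "K \<in> carrier_mat m m" "invertible_mat K"
        using GH that unfolding K_def by auto
      then obtain Z where Z: "Z \<in> carrier_mat m m" "K * Z = 1\<^sub>m m" "Z * K = 1\<^sub>m m"
        by (metis invertible_mat_obtain_inverse)
      have "G + t \<cdot>\<^sub>m 0\<^sub>m m k = G"
        using GH by (intro eq_matI) auto
      then have Y: "B + t \<cdot>\<^sub>m zero_one m k = G @\<^sub>c K"
        using GH unfolding K_def by (simp add: append_cols_add_smult)
      have X: "one_zero m k + t \<cdot>\<^sub>m 0\<^sub>m m (m + k) = one_zero m k"
        by (intro eq_matI) (auto simp: append_cols_def)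
      define S where "S = four_block_mat (1\<^sub>m k) (0\<^sub>m k m) (- (Z * G)) Z"
      have S: "S \<in> carrier_mat (m + k) (m + k)"
        using GH Z unfolding S_def by (metis add.commute four_block_carrier_mat one_carrier_mat)
      have iS: "invertible_mat S"
        unfolding S_def using GH Z invertible_matI[OF Z(1) K(1) Z(3) Z(2)]
        by (intro invertible_mat_block_lower) (auto simp: invertible_mat_one)
      have "K * (- (Z * G)) = - G"
        using GH K Z by (intro mult_uminus_left_inverse) auto
      moreover have "G + - G = 0\<^sub>m m k"
        using GH by (intro eq_matI) auto
      ultimately have "(G @\<^sub>c K) * S = zero_one m k"
        using GH K Z unfolding S_def by (subst append_cols_mult_block[of _ m k _ m _ k _ m]) auto
      moreover have "E + - 0\<^sub>m m k = E"
        using E by (intro eq_matI) auto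
      then have "one_zero m k * S = one_zero m k"
        using E GH Z unfolding S_def one_zero by (subst append_cols_mult_block[of _ m k _ m _ k _ m]) auto
      moreover have "G @\<^sub>c K \<in> carrier_mat m (m + k)"
        using GH K by (metis add.commute append_cols_carrier)
      ultimately show ?thesis
        unfolding X Y using S iS left_mult_one_mat[OF one_zero_carrier[of m k]]
        by (intro pair_equivI[of _ _ _ _ "1\<^sub>m m" S]) (auto simp: invertible_mat_one)
    qed
  qed (use B in auto)
qed

lemma four_block_split:
  assumes "B \<in> carrier_mat (p + r) (q + s)"
  obtains B\<^sub>1 B\<^sub>2 B\<^sub>3 B\<^sub>4 where "B\<^sub>1 \<in> carrier_mat p q" "B\<^sub>2 \<in> carrier_mat p s" "B\<^sub>3 \<in> carrier_mat r q"
    "B\<^sub>4 \<in> carrier_mat r s" "B = four_block_mat B\<^sub>1 B\<^sub>2 B\<^sub>3 B\<^sub>4"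
proof (rule that)
  show "B = four_block_mat
      (mat p q (\<lambda>(i, j). B $$ (i, j))) (mat p s (\<lambda>(i, j). B $$ (i, q + j)))
      (mat r q (\<lambda>(i, j). B $$ (p + i, j))) (mat r s (\<lambda>(i, j). B $$ (p + i, q + j)))"
    using assms by (intro eq_matI) auto
qed auto

text \<open>With the trailing block of \<open>B\<close> invertible, the blocks above and to the left of it are cleared by
  row and column operations, leaving a Schur complement. The row operations add multiples of \<open>a\<close> to
  \<open>A\<close>; the column operations have no effect on the first matrix, whose last \<open>k\<close> columns vanish.\<close>

lemma approximable_via_trailing_block:
  assumes closed: "equivalence_closed (p + k) (q + k) P"
    and A: "A \<in> carrier_mat p q" "a \<in> carrier_mat k q" and B: "B \<in> carrier_mat (p + k) (q + k)"
    and norm: "\<And>X Y. X \<in> carrier_mat p q \<Longrightarrow> Y \<in> carrier_mat p q \<Longrightarrow>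
      approximable (p + k) (q + k) P (four_block_mat X (0\<^sub>m p k) a (0\<^sub>m k k))
        (four_block_mat Y (0\<^sub>m p k) (0\<^sub>m k q) (1\<^sub>m k))"
  shows "approximable (p + k) (q + k) P (four_block_mat A (0\<^sub>m p k) a (0\<^sub>m k k)) B"
proof -
  let ?A = "four_block_mat A (0\<^sub>m p k) a (0\<^sub>m k k)"
  obtain B\<^sub>1 B\<^sub>2 B\<^sub>3 B\<^sub>4 where B1234: "B\<^sub>1 \<in> carrier_mat p q" "B\<^sub>2 \<in> carrier_mat p k" "B\<^sub>3 \<in> carrier_mat k q"
    "B\<^sub>4 \<in> carrier_mat k k" "B = four_block_mat B\<^sub>1 B\<^sub>2 B\<^sub>3 B\<^sub>4"
    using four_block_split[OF B] .
  let ?P = "\<lambda>X Y. X = ?A \<and> (\<exists>C \<in> carrier_mat k k. invertible_mat C \<and> Y = four_block_mat B\<^sub>1 B\<^sub>2 B\<^sub>3 C)"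
  let ?C = "0\<^sub>m (p + k) (q + k)" and ?D = "four_block_mat (0\<^sub>m p q) (0\<^sub>m p k) (0\<^sub>m k q) (1\<^sub>m k)"
  have "approximable (p + k) (q + k) ?P ?A B"
  proof (rule approximable_along_line[of _ "p + k" "q + k" _ ?C ?D,
        OF _ _ _ _ finite_singular_shifts[OF B1234(4)]])
    show "?P (?A + t \<cdot>\<^sub>m ?C) (B + t \<cdot>\<^sub>m ?D)" if "invertible_mat (B\<^sub>4 + t \<cdot>\<^sub>m 1\<^sub>m k)" for t
    proof -
      have "?A + t \<cdot>\<^sub>m ?C = ?A"
        using A by (intro eq_matI) auto
      moreover have "B + t \<cdot>\<^sub>m ?D = four_block_mat B\<^sub>1 B\<^sub>2 B\<^sub>3 (B\<^sub>4 + t \<cdot>\<^sub>m 1\<^sub>m k)"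
        using B1234 by (intro eq_matI) auto
      ultimately show ?thesis
        using B1234 that by (intro conjI bexI[of _ "B\<^sub>4 + t \<cdot>\<^sub>m 1\<^sub>m k"]) auto
    qed
  qed (use A B in auto)
  then show ?thesis
  proof (rule approximable_trans)
    fix X Y :: "complex mat"
    assume XY: "X \<in> carrier_mat (p + k) (q + k)" "Y \<in> carrier_mat (p + k) (q + k)" and "?P X Y"
    then obtain C where X: "X = ?A" and C: "C \<in> carrier_mat k k" "invertible_mat C"
      and Y: "Y = four_block_mat B\<^sub>1 B\<^sub>2 B\<^sub>3 C" by blast
    then obtain Z where Z: "Z \<in> carrier_mat k k" "C * Z = 1\<^sub>m k" "Z * C = 1\<^sub>m k"
      by (metis invertible_mat_obtain_inverse)
    have iZ: "invertible_mat Z"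
      using Z C invertible_matI by blast
    define R where "R = four_block_mat (1\<^sub>m p) (- (B\<^sub>2 * Z)) (0\<^sub>m k p) (1\<^sub>m k)"
    define S where "S = four_block_mat (1\<^sub>m q) (0\<^sub>m q k) (- (Z * B\<^sub>3)) Z"
    define X' where "X' = A + - (B\<^sub>2 * Z) * a"
    define Y' where "Y' = B\<^sub>1 + - (B\<^sub>2 * Z) * B\<^sub>3"
    have c: "X' \<in> carrier_mat p q" "Y' \<in> carrier_mat p q"
      using A B1234 Z unfolding X'_def Y'_def by auto
    have RX: "R * X = four_block_mat X' (0\<^sub>m p k) a (0\<^sub>m k k)"
      using A B1234 Z unfolding R_def X X'_def
      by (subst mult_four_block_mat[of _ p p _ k _ k _ _ q _ k]) auto
    have "- (B\<^sub>2 * Z) * C = - B\<^sub>2"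
      using B1234 C Z by (intro uminus_mult_right_inverse) auto
    moreover have "B\<^sub>2 + - B\<^sub>2 = 0\<^sub>m p k"
      using B1234 by (intro eq_matI) auto
    ultimately have RY: "R * Y = four_block_mat Y' (0\<^sub>m p k) B\<^sub>3 C"
      using C B1234 Z unfolding R_def Y Y'_def
      by (subst mult_four_block_mat[of _ p p _ k _ k _ _ q _ k]) auto
    have RXS: "R * X * S = four_block_mat X' (0\<^sub>m p k) a (0\<^sub>m k k)"
      using c A B1234 Z unfolding RX S_def
      by (subst mult_four_block_mat[of _ p q _ k _ k _ _ q _ k]) auto
    have "C * (- (Z * B\<^sub>3)) = - B\<^sub>3"
      using B1234 C Z by (intro mult_uminus_left_inverse) auto
    moreover have "B\<^sub>3 + - B\<^sub>3 = 0\<^sub>m k q"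
      using B1234 by (intro eq_matI) auto
    ultimately have RYS: "R * Y * S = four_block_mat Y' (0\<^sub>m p k) (0\<^sub>m k q) (1\<^sub>m k)"
      using c C B1234 Z unfolding RY S_def
      by (subst mult_four_block_mat[of _ p q _ k _ k _ _ q _ k]) auto
    have "invertible_mat R" "invertible_mat S"
      unfolding R_def S_def using B1234 Z iZ
      by (auto intro!: invertible_mat_block_upper invertible_mat_block_lower simp: invertible_mat_one)
    moreover have "R \<in> carrier_mat (p + k) (p + k)" "S \<in> carrier_mat (q + k) (q + k)"
      unfolding R_def S_def using B1234 Z by auto
    ultimately have "pair_equiv (p + k) (q + k) (X, Y) (four_block_mat X' (0\<^sub>m p k) a (0\<^sub>m k k),
        four_block_mat Y' (0\<^sub>m p k) (0\<^sub>m k q) (1\<^sub>m k))"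
      using XY RXS RYS by (intro pair_equivI[of _ _ _ _ R S]) auto
    then show "approximable (p + k) (q + k) P X Y"
      using norm[OF c] by (rule approximable_pair_equiv[OF closed])
  qed
qed

text \<open>Approximating the subpencil \<open>(A, B)\<close> inside the block pencil is the step that makes induction
  on the size possible.\<close>

lemma approximable_block_extension:
  assumes appr: "approximable p q P A B" and a: "a \<in> carrier_mat k q"
    and ext: "\<And>X Y. X \<in> carrier_mat p q \<Longrightarrow> Y \<in> carrier_mat p q \<Longrightarrow> P X Y \<Longrightarrow>
      approximable (p + k) (q + k) Q (four_block_mat X (0\<^sub>m p k) a (0\<^sub>m k k))
        (four_block_mat Y (0\<^sub>m p k) (0\<^sub>m k q) (1\<^sub>m k))"
  shows "approximable (p + k) (q + k) Q (four_block_mat A (0\<^sub>m p k) a (0\<^sub>m k k))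
    (four_block_mat B (0\<^sub>m p k) (0\<^sub>m k q) (1\<^sub>m k))"
proof -
  let ?f = "\<lambda>X. four_block_mat X (0\<^sub>m p k) (0\<^sub>m k q) (0\<^sub>m k k) :: complex mat"
  let ?\<phi> = "\<lambda>X. four_block_mat X (0\<^sub>m p k) a (0\<^sub>m k k)"
  let ?\<psi> = "\<lambda>X. four_block_mat X (0\<^sub>m p k) (0\<^sub>m k q) (1\<^sub>m k) :: complex mat"
  have "approximable (p + k) (q + k) (approximable (p + k) (q + k) Q) (?\<phi> A) (?\<psi> B)"
  proof (rule approximable_affine_image[OF appr, where f = ?f and \<phi> = ?\<phi> and \<psi> = ?\<psi>])
    show "X = 0\<^sub>m p q" if X: "X \<in> carrier_mat p q" "?f X = 0\<^sub>m (p + k) (q + k)" for X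
    proof (rule eq_matI)
      fix i j
      assume ij: "i < dim_row (0\<^sub>m p q :: complex mat)" "j < dim_col (0\<^sub>m p q :: complex mat)"
      then have "X $$ (i, j) = ?f X $$ (i, j)"
        using X(1) by simp
      also have "\<dots> = 0"
        using X(2) ij by simp
      finally show "X $$ (i, j) = 0\<^sub>m p q $$ (i, j)"
        using ij by simp
    qed (use X in auto)
    show "?f (X + Y) = ?f X + ?f Y" if "X \<in> carrier_mat p q" "Y \<in> carrier_mat p q" for X Y
      using that by (intro eq_matI) auto
    show "?f (c \<cdot>\<^sub>m X) = c \<cdot>\<^sub>m ?f X" if "X \<in> carrier_mat p q" for c X
      using that by (intro eq_matI) auto
    show "?\<phi> X - ?\<phi> Y = ?f (X - Y)" if "X \<in> carrier_mat p q" "Y \<in> carrier_mat p q" for X Y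
      using that a by (intro eq_matI) auto
    show "?\<psi> X - ?\<psi> Y = ?f (X - Y)" if "X \<in> carrier_mat p q" "Y \<in> carrier_mat p q" for X Y
      using that by (intro eq_matI) auto
  qed (use a ext in auto)
  then show ?thesis
    by (rule approximable_trans)
qed

text \<open>Transforming the subpencil by \<open>R\<close> and \<open>S\<close> multiplies the coupling row \<open>a\<close> by \<open>S\<close> on the right.
  Nothing is known about the outcome \<open>b\<close>; it is made generic by a further perturbation.\<close>

lemma pair_equiv_block_extension:
  assumes "pair_equiv p q (X, Y) (X', Y')" and a: "a \<in> carrier_mat k q"
  obtains b where "b \<in> carrier_mat k q"
    "pair_equiv (p + k) (q + k)
      (four_block_mat X (0\<^sub>m p k) a (0\<^sub>m k k), four_block_mat Y (0\<^sub>m p k) (0\<^sub>m k q) (1\<^sub>m k))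
      (four_block_mat X' (0\<^sub>m p k) b (0\<^sub>m k k), four_block_mat Y' (0\<^sub>m p k) (0\<^sub>m k q) (1\<^sub>m k))"
proof -
  obtain R S where XY: "X \<in> carrier_mat p q" "Y \<in> carrier_mat p q"
    and RS: "R \<in> carrier_mat p p" "S \<in> carrier_mat q q" "invertible_mat R" "invertible_mat S"
    and eq: "X' = R * X * S" "Y' = R * Y * S"
    using assms(1) by (auto simp: pair_equiv.simps)
  define R' where "R' = four_block_mat R (0\<^sub>m p k) (0\<^sub>m k p) (1\<^sub>m k)"
  define S' where "S' = four_block_mat S (0\<^sub>m q k) (0\<^sub>m k q) (1\<^sub>m k)"
  have mult: "R' * four_block_mat U (0\<^sub>m p k) V W * S' = four_block_mat (R * U * S) (0\<^sub>m p k) (V * S) W"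
    if "U \<in> carrier_mat p q" "V \<in> carrier_mat k q" "W \<in> carrier_mat k k" for U V W
  proof -
    have "R' * four_block_mat U (0\<^sub>m p k) V W = four_block_mat (R * U) (0\<^sub>m p k) V W"
      using RS that unfolding R'_def by (subst mult_four_block_mat[of _ p p _ k _ k _ _ q _ k]) auto
    also have "\<dots> * S' = four_block_mat (R * U * S) (0\<^sub>m p k) (V * S) W"
      using RS that unfolding S'_def by (subst mult_four_block_mat[of _ p q _ k _ k _ _ q _ k]) auto
    finally show ?thesis .
  qed
  have inv: "invertible_mat R'" "invertible_mat S'"
    unfolding R'_def S'_def using RS
    by (auto intro!: invertible_mat_block_upper simp: invertible_mat_one)
  have "R' \<in> carrier_mat (p + k) (p + k)" "S' \<in> carrier_mat (q + k) (q + k)"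
    unfolding R'_def S'_def using RS by auto
  then have "pair_equiv (p + k) (q + k)
      (four_block_mat X (0\<^sub>m p k) a (0\<^sub>m k k), four_block_mat Y (0\<^sub>m p k) (0\<^sub>m k q) (1\<^sub>m k))
      (four_block_mat X' (0\<^sub>m p k) (a * S) (0\<^sub>m k k), four_block_mat Y' (0\<^sub>m p k) (0\<^sub>m k q) (1\<^sub>m k))"
    using XY a RS inv by (intro pair_equivI[of _ _ _ _ R' S']) (auto simp: mult eq)
  then show ?thesis
    using that[of "a * S"] a RS by simp
qed

lemma one_zero_block:
  "one_zero (p + k) k = four_block_mat (one_zero p k) (0\<^sub>m p k) (zero_one k p) (0\<^sub>m k k)"
  unfolding append_cols_def by (intro eq_matI) auto

lemma zero_one_block:
  "zero_one (p + k) k = four_block_mat (zero_one p k) (0\<^sub>m p k) (0\<^sub>m k (p + k)) (1\<^sub>m k)"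
  unfolding append_cols_def by (intro eq_matI) auto

text \<open>The block row operation with \<open>W = -b\<^sub>2\<inverse> b\<^sub>1\<close> and \<open>b\<^sub>2\<inverse>\<close> turns \<open>[b\<^sub>1 b\<^sub>2]\<close> into \<open>[0 I]\<close>, using
  the rows \<open>[I 0]\<close> above. In the second matrix it turns the last block row \<open>[0 I]\<close> into
  \<open>[W F  b\<^sub>2\<inverse>]\<close> with \<open>F = [0 I]\<close>. This is undone by operations with the last \<open>k\<close> columns, which
  vanish in the first matrix.\<close>

lemma pair_equiv_normalize_coupling:
  assumes b: "b\<^sub>1 \<in> carrier_mat k p" "b\<^sub>2 \<in> carrier_mat k k" "invertible_mat b\<^sub>2"
  shows "pair_equiv (p + k) (p + k + k)
    (four_block_mat (one_zero p k) (0\<^sub>m p k) (b\<^sub>1 @\<^sub>c b\<^sub>2) (0\<^sub>m k k),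
     four_block_mat (zero_one p k) (0\<^sub>m p k) (0\<^sub>m k (p + k)) (1\<^sub>m k))
    (one_zero (p + k) k, zero_one (p + k) k)"
proof -
  obtain Z where Z: "Z \<in> carrier_mat k k" "b\<^sub>2 * Z = 1\<^sub>m k" "Z * b\<^sub>2 = 1\<^sub>m k"
    using b by (metis invertible_mat_obtain_inverse)
  have iZ: "invertible_mat Z"
    using Z b invertible_matI by blast
  define E where "E = one_zero p k"
  define F where "F = zero_one p k"
  define G where "G = zero_one k p"
  have E: "E \<in> carrier_mat p (p + k)" and F: "F \<in> carrier_mat p (p + k)"
    and G: "G \<in> carrier_mat k (p + k)"
    using zero_one_carrier[of k p] unfolding E_def F_def G_def by (simp_all add: add.commute[of k p])
  let ?X = "four_block_mat E (0\<^sub>m p k) (b\<^sub>1 @\<^sub>c b\<^sub>2) (0\<^sub>m k k)"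
  let ?Y = "four_block_mat F (0\<^sub>m p k) (0\<^sub>m k (p + k)) (1\<^sub>m k)"
  define W where "W = - (Z * b\<^sub>1)"
  have W: "W \<in> carrier_mat k p"
    using Z b unfolding W_def by simp
  define R where "R = four_block_mat (1\<^sub>m p) (0\<^sub>m p k) W Z"
  \<comment> \<open>The last block row of \<open>S\<close> solves \<open>W F + Z U = 0\<close> and \<open>Z V = I\<close> for \<open>[U V]\<close>.\<close>
  define S where "S = four_block_mat (1\<^sub>m (p + k)) (0\<^sub>m (p + k) k) (b\<^sub>1 * F) b\<^sub>2"
  have bF: "b\<^sub>1 * F \<in> carrier_mat k (p + k)"
    using b F by simp
  have bb: "b\<^sub>1 @\<^sub>c b\<^sub>2 \<in> carrier_mat k (p + k)"
    using b by simp
  have coupling: "W * E + Z * (b\<^sub>1 @\<^sub>c b\<^sub>2) = G"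
  proof -
    have "W * E = W @\<^sub>c 0\<^sub>m k k"
      using W mult_append_cols[of W k p "1\<^sub>m p" p "0\<^sub>m p k" k] unfolding E_def by simp
    moreover have "Z * (b\<^sub>1 @\<^sub>c b\<^sub>2) = Z * b\<^sub>1 @\<^sub>c 1\<^sub>m k"
      using b Z mult_append_cols[of Z k k b\<^sub>1 p b\<^sub>2 k] by simp
    moreover have "W + Z * b\<^sub>1 = 0\<^sub>m k p"
      using Z b unfolding W_def by (intro eq_matI) auto
    ultimately show ?thesis
      using W Z b unfolding G_def by (simp add: append_cols_add[of _ k p _ _ k])
  qed
  have cancel: "W * F + Z * (b\<^sub>1 * F) = 0\<^sub>m k (p + k)"
  proof -
    have M: "Z * b\<^sub>1 * F \<in> carrier_mat k (p + k)"
      by (rule mult_carrier_mat[OF mult_carrier_mat[OF Z(1) b(1)] F])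
    have "W * F = - (Z * b\<^sub>1 * F)"
      using Z b carrier_matD[OF F] unfolding W_def by (intro uminus_mult_left_mat) auto
    moreover have "- N + N = 0\<^sub>m k (p + k)" if "N \<in> carrier_mat k (p + k)" for N :: "complex mat"
      using that by (intro eq_matI) auto
    ultimately show ?thesis
      using M by (simp only: assoc_mult_mat[OF Z(1) b(1) F, symmetric])
  qed
  have RX: "R * ?X = four_block_mat E (0\<^sub>m p k) G (0\<^sub>m k k)"
    using E W Z bb unfolding R_def
    by (subst mult_four_block_mat[of _ p p _ k _ k _ _ "p + k" _ k]) (auto simp: coupling)
  have "R * ?X * S = four_block_mat E (0\<^sub>m p k) G (0\<^sub>m k k)"
    using E bF b G unfolding RX S_def
    by (subst mult_four_block_mat[of _ p "p + k" _ k _ k _ _ "p + k" _ k]) auto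
  then have RXS: "R * ?X * S = one_zero (p + k) k"
    unfolding one_zero_block E_def G_def .
  have RY: "R * ?Y = four_block_mat F (0\<^sub>m p k) (W * F) Z"
    using F W Z unfolding R_def
    by (subst mult_four_block_mat[of _ p p _ k _ k _ _ "p + k" _ k]) auto
  have "R * ?Y * S = four_block_mat F (0\<^sub>m p k) (0\<^sub>m k (p + k)) (1\<^sub>m k)"
    using F W bF b Z cancel unfolding RY S_def
    by (subst mult_four_block_mat[of _ p "p + k" _ k _ k _ _ "p + k" _ k]) auto
  then have RYS: "R * ?Y * S = zero_one (p + k) k"
    unfolding zero_one_block F_def .
  have "invertible_mat R" "invertible_mat S"
    unfolding R_def S_def using W Z iZ bF b
    by (auto intro!: invertible_mat_block_lower simp: invertible_mat_one)
  moreover have "R \<in> carrier_mat (p + k) (p + k)" "S \<in> carrier_mat (p + k + k) (p + k + k)"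
    unfolding R_def S_def using W Z bF b by auto
  moreover have "?X \<in> carrier_mat (p + k) (p + k + k)" "?Y \<in> carrier_mat (p + k) (p + k + k)"
    using E F by auto
  ultimately show ?thesis
    unfolding E_def[symmetric] F_def[symmetric]
    using RXS RYS by (intro pair_equivI[of _ _ _ _ R S]) simp_all
qed

lemma approximable_generic_coupling:
  assumes b: "b \<in> carrier_mat k (p + k)"
  shows "approximable (p + k) (p + k + k)
    (\<lambda>X Y. pair_equiv (p + k) (p + k + k) (X, Y) (one_zero (p + k) k, zero_one (p + k) k))
    (four_block_mat (one_zero p k) (0\<^sub>m p k) b (0\<^sub>m k k))
    (four_block_mat (zero_one p k) (0\<^sub>m p k) (0\<^sub>m k (p + k)) (1\<^sub>m k))"
    (is "approximable _ _ ?P ?A ?B")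
proof -
  obtain b\<^sub>1 b\<^sub>2 where b12: "b\<^sub>1 \<in> carrier_mat k p" "b\<^sub>2 \<in> carrier_mat k k" "b = b\<^sub>1 @\<^sub>c b\<^sub>2"
    using append_cols_split[OF b] .
  let ?C = "four_block_mat (0\<^sub>m p (p + k)) (0\<^sub>m p k) (zero_one k p) (0\<^sub>m k k)"
  let ?D = "0\<^sub>m (p + k) (p + k + k)"
  show ?thesis
  proof (rule approximable_along_line[of _ "p + k" "p + k + k" _ ?C ?D,
        OF _ _ _ _ finite_singular_shifts[OF b12(2)]])
    fix t :: complex
    assume inv: "invertible_mat (b\<^sub>2 + t \<cdot>\<^sub>m 1\<^sub>m k)"
    have "?A + t \<cdot>\<^sub>m ?C = four_block_mat (one_zero p k) (0\<^sub>m p k) (b\<^sub>1 @\<^sub>c (b\<^sub>2 + t \<cdot>\<^sub>m 1\<^sub>m k)) (0\<^sub>m k k)"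
      using b12 by (intro eq_matI) (auto simp: append_cols_def)
    moreover have "?B + t \<cdot>\<^sub>m ?D = ?B"
      by (intro eq_matI) (auto simp: append_cols_def)
    ultimately show "?P (?A + t \<cdot>\<^sub>m ?C) (?B + t \<cdot>\<^sub>m ?D)"
      using pair_equiv_normalize_coupling[OF b12(1) _ inv] b12 by simp
  qed (use zero_one_carrier[of p k] one_zero_carrier[of p k] in \<open>auto simp: append_cols_def\<close>)
qed

text \<open>The excess \<open>k\<close> of columns stays fixed while the number of rows drops by \<open>k\<close>, in the manner of the
  Euclidean algorithm, until it is at most \<open>k\<close>.\<close>

lemma approximable_wide:
  assumes "k > 0" "A \<in> carrier_mat m (m + k)" "B \<in> carrier_mat m (m + k)"
  shows "approximable m (m + k) (\<lambda>X Y. pair_equiv m (m + k) (X, Y) (one_zero m k, zero_one m k)) A B"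
  using assms(2,3)
proof (induction m arbitrary: A B rule: less_induct)
  case (less m)
  let ?P = "\<lambda>X Y. pair_equiv m (m + k) (X, Y) (one_zero m k, zero_one m k)"
  have "approximable m (m + k) ?P (one_zero m k) Y" if Y: "Y \<in> carrier_mat m (m + k)" for Y
  proof (cases "m \<le> k")
    case True
    then show ?thesis
      using Y by (rule approximable_wide_short)
  next
    case False
    then obtain p where m: "m = p + k"
      by (metis add.commute le_Suc_ex nat_le_linear)
    have closed: "equivalence_closed (p + k) (p + k + k) ?P"
      unfolding m by (rule equivalence_closed_class)
    have Y': "Y \<in> carrier_mat (p + k) (p + k + k)"
      using Y unfolding m .
    have c: "zero_one k p \<in> carrier_mat k (p + k)"
      using zero_one_carrier[of k p] by (simp add: add.commute)
    have "approximable (p + k) (p + k + k) ?P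
        (four_block_mat (one_zero p k) (0\<^sub>m p k) (zero_one k p) (0\<^sub>m k k)) Y"
    proof (rule approximable_via_trailing_block[OF closed one_zero_carrier c Y'])
      fix U V :: "complex mat"
      assume UV: "U \<in> carrier_mat p (p + k)" "V \<in> carrier_mat p (p + k)"
      have "p < m"
        using \<open>k > 0\<close> m by simp
      then have "approximable p (p + k)
          (\<lambda>X Y. pair_equiv p (p + k) (X, Y) (one_zero p k, zero_one p k)) U V"
        using UV by (rule less.IH)
      then show "approximable (p + k) (p + k + k) ?P
          (four_block_mat U (0\<^sub>m p k) (zero_one k p) (0\<^sub>m k k))
          (four_block_mat V (0\<^sub>m p k) (0\<^sub>m k (p + k)) (1\<^sub>m k))"
      proof (rule approximable_block_extension[OF _ c])
        fix U' V' :: "complex mat"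
        assume "pair_equiv p (p + k) (U', V') (one_zero p k, zero_one p k)"
        then obtain b where b: "b \<in> carrier_mat k (p + k)" and
          equiv: "pair_equiv (p + k) (p + k + k)
            (four_block_mat U' (0\<^sub>m p k) (zero_one k p) (0\<^sub>m k k),
             four_block_mat V' (0\<^sub>m p k) (0\<^sub>m k (p + k)) (1\<^sub>m k))
            (four_block_mat (one_zero p k) (0\<^sub>m p k) b (0\<^sub>m k k),
             four_block_mat (zero_one p k) (0\<^sub>m p k) (0\<^sub>m k (p + k)) (1\<^sub>m k))"
          by (rule pair_equiv_block_extension[OF _ c])
        show "approximable (p + k) (p + k + k) ?P
            (four_block_mat U' (0\<^sub>m p k) (zero_one k p) (0\<^sub>m k k))
            (four_block_mat V' (0\<^sub>m p k) (0\<^sub>m k (p + k)) (1\<^sub>m k))"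
          using equiv approximable_generic_coupling[OF b] unfolding m
          by (rule approximable_pair_equiv[OF closed[unfolded m]])
      qed
    qed
    then show ?thesis
      unfolding m one_zero_block by simp
  qed
  then show ?case
    by (rule approximable_via_leading_block[OF equivalence_closed_class less.prems])
qed

section \<open>Tall pencils\<close>

lemma pair_equiv_transpose:
  assumes "pair_equiv m n (A\<^sub>1, A\<^sub>2) (B\<^sub>1, B\<^sub>2)"
  shows "pair_equiv n m (transpose_mat A\<^sub>1, transpose_mat A\<^sub>2) (transpose_mat B\<^sub>1, transpose_mat B\<^sub>2)"
proof -
  obtain R S where A: "A\<^sub>1 \<in> carrier_mat m n" "A\<^sub>2 \<in> carrier_mat m n"
    and RS: "R \<in> carrier_mat m m" "S \<in> carrier_mat n n" "invertible_mat R" "invertible_mat S"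
    and B: "B\<^sub>1 = R * A\<^sub>1 * S" "B\<^sub>2 = R * A\<^sub>2 * S"
    using assms by (auto simp: pair_equiv.simps)
  have "transpose_mat (R * X * S) = transpose_mat S * transpose_mat X * transpose_mat R"
    if X: "X \<in> carrier_mat m n" for X
  proof -
    have "transpose_mat (R * X * S) = transpose_mat S * (transpose_mat X * transpose_mat R)"
      using RS X by (simp add: transpose_mult[of _ m n _ n] transpose_mult[of _ m m _ n])
    also have "\<dots> = transpose_mat S * transpose_mat X * transpose_mat R"
      using RS X by (intro assoc_mult_mat[symmetric, of _ n n _ m _ m]) auto
    finally show ?thesis .
  qed
  then show ?thesis
    using A RS unfolding B
    by (intro pair_equivI[of _ _ _ _ "transpose_mat S" "transpose_mat R"]) (auto intro: invertible_mat_transpose)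
qed

lemma approximable_transpose:
  assumes "approximable m n (\<lambda>X Y. pair_equiv m n (X, Y) (C, D)) A B"
  shows "approximable n m (\<lambda>X Y. pair_equiv n m (X, Y) (transpose_mat C, transpose_mat D))
    (transpose_mat A) (transpose_mat B)"
proof (rule approximable_affine_image[OF assms, where f = transpose_mat])
  show "X = 0\<^sub>m m n" if "X \<in> carrier_mat m n" "transpose_mat X = 0\<^sub>m n m" for X :: "complex mat"
    using that by (metis transpose_transpose zero_transpose_mat)
  show "transpose_mat (X + Y) = transpose_mat X + transpose_mat Y"
    if "X \<in> carrier_mat m n" "Y \<in> carrier_mat m n" for X Y :: "complex mat"
    using that by (intro eq_matI) auto
  show "transpose_mat (c \<cdot>\<^sub>m X) = c \<cdot>\<^sub>m transpose_mat X" for c and X :: "complex mat"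
    by (intro eq_matI) auto
  show "transpose_mat X - transpose_mat Y = transpose_mat (X - Y)"
    if "X \<in> carrier_mat m n" "Y \<in> carrier_mat m n" for X Y :: "complex mat"
    using that by (intro eq_matI) auto
  then show "\<And>X Y :: complex mat. X \<in> carrier_mat m n \<Longrightarrow> Y \<in> carrier_mat m n \<Longrightarrow>
      transpose_mat X - transpose_mat Y = transpose_mat (X - Y)" .
qed (auto intro: pair_equiv_transpose)

section \<open>Normal forms of generic pencils\<close>

theorem theorem1p1:
  fixes m n :: nat and A B :: "complex mat" and nrm :: "complex mat \<Rightarrow> real" and \<epsilon> :: real
  assumes "A \<in> carrier_mat m n" and "B \<in> carrier_mat m n"
    and "matrix_norm m n nrm"
    and "\<epsilon> > 0"
  shows "\<exists>A' \<in> carrier_mat m n. \<exists>B' \<in> carrier_mat m n.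
    nrm (A - A') < \<epsilon> \<and> nrm (B - B') < \<epsilon> \<and>
    (m = n \<longrightarrow> (\<exists>\<alpha> :: nat \<Rightarrow> complex. pair_equiv m n (A', B') (1\<^sub>m n, mat_diag n \<alpha>))) \<and>
    (m < n \<longrightarrow> pair_equiv m n (A', B')
       (1\<^sub>m m @\<^sub>c 0\<^sub>m m (n - m), 0\<^sub>m m (n - m) @\<^sub>c 1\<^sub>m m)) \<and>
    (m > n \<longrightarrow> pair_equiv m n (A', B')
       (transpose_mat (1\<^sub>m n @\<^sub>c 0\<^sub>m n (m - n)), transpose_mat (0\<^sub>m n (m - n) @\<^sub>c 1\<^sub>m n)))"
proof -
  consider "m = n" | "m < n" | "m > n"
    by linarith
  then have "approximable m n (\<lambda>A' B'.
    (m = n \<longrightarrow> (\<exists>\<alpha> :: nat \<Rightarrow> complex. pair_equiv m n (A', B') (1\<^sub>m n, mat_diag n \<alpha>))) \<and>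
    (m < n \<longrightarrow> pair_equiv m n (A', B')
       (1\<^sub>m m @\<^sub>c 0\<^sub>m m (n - m), 0\<^sub>m m (n - m) @\<^sub>c 1\<^sub>m m)) \<and>
    (m > n \<longrightarrow> pair_equiv m n (A', B')
       (transpose_mat (1\<^sub>m n @\<^sub>c 0\<^sub>m n (m - n)), transpose_mat (0\<^sub>m n (m - n) @\<^sub>c 1\<^sub>m n)))) A B"
  proof cases
    case 1
    then show ?thesis
      using approximable_identity_diagonal[of A n B] assms by simp
  next
    case 2
    then show ?thesis
      using approximable_wide[of "n - m" A m B] assms by simp
  next
    case 3
    then show ?thesis
      using approximable_transpose[OF approximable_wide[of "m - n" "transpose_mat A" n "transpose_mat B"]] assms
      by simp
  qed
  then show ?thesis
    using assms(3,4) unfolding approximable_def by blast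
qed

end
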